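(* Let $\lambda^F,\lambda^G,\lambda^H,\lambda^P,\lambda^Q,\lambda^R$ be the left-invariant one-forms on the real Jacobi group $G^J_1(\mathbb{R})$ defined by $g^{-1}\mathrm{d}g=\lambda^FF+\lambda^GG+\lambda^HH+\lambda^PP+\lambda^QQ+\lambda^RR$. The left-invariant vector fields $L^A$ on $G^J_1(\mathbb{R})$ dual to them, i.e. with $\langle\lambda^B\,|\,L^A\rangle=\delta_{A,B}$ for $A,B\in\{F,G,H,P,Q,R\}$, are given in the S-coordinates $(x,y,\theta,p,q,\kappa)$ by $$L^F=y\cos2\theta\,\partial_x+y\sin2\theta\,\partial_y+\sin^2\theta\,\partial_\theta,$$ $$L^G=y\cos2\theta\,\partial_x+y\sin2\theta\,\partial_y-\cos^2\theta\,\partial_\theta,$$ $$L^H=-2y\sin2\theta\,\partial_x+2y\cos2\theta\,\partial_y+\sin2\theta\,\partial_\theta,$$ $$L^P=d\,\partial_p-b\,\partial_q-(pb+qd)\partial_\kappa=\frac{\cos\theta}{y^{1/2}}\partial_p-\frac{x\cos\theta+y\sin\theta}{y^{1/2}}\partial_q-\frac1{y^{1/2}}\big[p(x\cos\theta+y\sin\theta)+q\cos\theta\big]\partial_\kappa,$$ $$L^Q=-c\,\partial_p+a\,\partial_q+(pa+qc)\partial_\kappa=\frac{\sin\theta}{y^{1/2}}\partial_p+\frac{y\cos\theta-x\sin\theta}{y^{1/2}}\partial_q+\frac1{y^{1/2}}\big[p(y\cos\theta-x\sin\theta)-q\sin\theta\big]\partial_\kappa,$$ $$L^R=\partial_\kappa.$$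 They satisfy the same commutation relations as the generators $F,G,H,P,Q,R$ of the Lie algebra of $G^J_1(\mathbb{R})$: $[L^F,L^G]=L^H$, $[L^G,L^H]=2L^G$, $[L^H,L^F]=2L^F$, $[L^P,L^Q]=2L^R$, $[L^P,L^F]=L^Q$, $[L^Q,L^G]=L^P$, $[L^P,L^H]=L^P$, $[L^H,L^Q]=L^Q$, all other brackets among them (up to antisymmetry) being zero.
   Context: The real Jacobi group $G^J_1(\mathbb{R})$ is the group of real matrices $$g=\begin{pmatrix}a&0&b&q\\ \lambda&1&\mu&\kappa\\ c&0&d&-p\\0&0&0&1\end{pmatrix},\quad M=\begin{pmatrix}a&b\\c&d\end{pmatrix},\ \det M=1,\quad (p,q)=(\lambda,\mu)M^{-1},\ \kappa\in\mathbb{R}.$$ The S-coordinates are $(x,y,\theta,p,q,\kappa)$ with $(x,y,\theta)$, $y>0$, given by the Iwasawa decomposition of $M$: $a=y^{1/2}\cos\theta-xy^{-1/2}\sin\theta$, $b=y^{1/2}\sin\theta+xy^{-1/2}\cos\theta$, $c=-y^{-1/2}\sin\theta$, $d=y^{-1/2}\cos\theta$. With $E_{ij}$ the elementary $4\times4$ matrices, the Lie algebra has basis $F=E_{13}$, $G=E_{31}$, $H=E_{11}-E_{33}$, $P=E_{21}-E_{34}$, $Q=E_{14}+E_{23}$, $R=E_{24}$. *)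

theory Defs
  imports "HOL-Analysis.Analysis"
begin

section \<open>The real Jacobi group and its Lie algebra\<close>

definition jacobi_matrix :: "real^2^2 \<Rightarrow> real^2 \<Rightarrow> real^2 \<Rightarrow> real \<Rightarrow> real^4^4" where
  "jacobi_matrix M l w \<kappa> =
     vector [vector [M$1$1, 0, M$1$2, w$2],
             vector [l$1,   1, l$2,   \<kappa>],
             vector [M$2$1, 0, M$2$2, - w$1],
             vector [0,     0, 0,     1]]"

definition jacobi_group :: "(real^4^4) set" where
  "jacobi_group = {jacobi_matrix M l w \<kappa> | M l w \<kappa>. det M = 1 \<and> w = l v* matrix_inv M}"

datatype jacobi_gen = GenF | GenG | GenH | GenP | GenQ | GenR

lemma UNIV_jacobi_gen: "UNIV = {GenF, GenG, GenH, GenP, GenQ, GenR}"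
  using jacobi_gen.exhaust by auto

instance jacobi_gen :: finite
  by standard (simp add: UNIV_jacobi_gen)

definition E :: "4 \<Rightarrow> 4 \<Rightarrow> real^4^4" where
  "E i j = axis i (axis j 1)"

fun gen :: "jacobi_gen \<Rightarrow> real^4^4" where
  "gen GenF = E 1 3"
| "gen GenG = E 3 1"
| "gen GenH = E 1 1 - E 3 3"
| "gen GenP = E 2 1 - E 3 4"
| "gen GenQ = E 1 4 + E 2 3"
| "gen GenR = E 2 4"

text \<open>The commutation relations of the six generators, for a bracket operation indexed by pairs of
  generators. Brackets whose index pair is not listed (in either order) vanish.\<close>

definition jacobi_commutation_relations ::
    "(jacobi_gen \<Rightarrow> jacobi_gen \<Rightarrow> 'v::real_vector) \<Rightarrow> (jacobi_gen \<Rightarrow> 'v) \<Rightarrow> bool" where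
  "jacobi_commutation_relations br X \<longleftrightarrow>
     br GenF GenG = X GenH \<and>
     br GenG GenH = 2 *\<^sub>R X GenG \<and>
     br GenH GenF = 2 *\<^sub>R X GenF \<and>
     br GenP GenQ = 2 *\<^sub>R X GenR \<and>
     br GenP GenF = X GenQ \<and>
     br GenQ GenG = X GenP \<and>
     br GenP GenH = X GenP \<and>
     br GenH GenQ = X GenQ \<and>
     (\<forall>A B. {A, B} \<notin> {{GenF, GenG}, {GenG, GenH}, {GenH, GenF}, {GenP, GenQ},
                        {GenP, GenF}, {GenQ, GenG}, {GenP, GenH}, {GenH, GenQ}}
            \<longrightarrow> br A B = 0)"


section \<open>Invariant forms and their dual fields\<close>

text \<open>Velocities at \<open>0\<close> of curves in \<open>S\<close> through \<open>g\<close>. The group is an embedded submanifold of the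
  space of matrices, so requiring differentiability of the curve at \<open>0\<close> only already yields the usual
  tangent space.\<close>

definition tangent_space :: "'v::real_normed_vector set \<Rightarrow> 'v \<Rightarrow> 'v set" where
  "tangent_space S g =
     {v. \<exists>\<gamma> :: real \<Rightarrow> 'v. \<exists>\<epsilon>>0. (\<forall>t. \<bar>t\<bar> < \<epsilon> \<longrightarrow> \<gamma> t \<in> S) \<and> \<gamma> 0 = g \<and>
          (\<gamma> has_vector_derivative v) (at 0)}"

text \<open>\<open>left_form A g v\<close> is the value at the tangent vector \<open>v\<close> to the group at \<open>g\<close> of the one-form
  \<open>\<lambda>\<^sup>A\<close>, the coefficient of \<open>gen A\<close> in \<open>g\<^sup>-\<^sup>1 dg\<close>; here \<open>dg\<close> sends \<open>v\<close> to \<open>v\<close>.\<close>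

definition left_form :: "jacobi_gen \<Rightarrow> real^4^4 \<Rightarrow> real^4^4 \<Rightarrow> real" where
  "left_form A g v =
     (THE c. matrix_inv g ** v = (\<Sum>B\<in>UNIV. c B *\<^sub>R gen B)) A"

text \<open>\<open>left_field A g\<close> is the value at \<open>g\<close> of \<open>L\<^sup>A\<close>, as a tangent vector in the space of matrices.\<close>

definition left_field :: "jacobi_gen \<Rightarrow> real^4^4 \<Rightarrow> real^4^4" where
  "left_field A g =
     (THE v. v \<in> tangent_space jacobi_group g \<and>
             (\<forall>B. left_form B g v = (if A = B then 1 else 0)))"


section \<open>S-coordinates\<close>

text \<open>A tuple \<open>(x, y, \<theta>, p, q, \<kappa>)\<close> of coordinates, and likewise the tuple of components of a vector
  field with respect to \<open>\<partial>\<^sub>x, \<partial>\<^sub>y, \<partial>\<^sub>\<theta>, \<partial>\<^sub>p, \<partial>\<^sub>q, \<partial>\<^sub>\<kappa>\<close>.\<close>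

type_synonym s_coord = "real \<times> real \<times> real \<times> real \<times> real \<times> real"

definition iwasawa :: "real \<Rightarrow> real \<Rightarrow> real \<Rightarrow> real^2^2" where
  "iwasawa x y \<theta> =
     vector [vector [sqrt y * cos \<theta> - x / sqrt y * sin \<theta>, sqrt y * sin \<theta> + x / sqrt y * cos \<theta>],
             vector [- sin \<theta> / sqrt y, cos \<theta> / sqrt y]]"

text \<open>The angle is not reduced modulo \<open>2\<pi>\<close>: \<open>s_param\<close> is a local diffeomorphism from the half space
  \<open>y > 0\<close> onto the group. The second argument of \<open>jacobi_matrix\<close> is \<open>(\<lambda>, \<mu>) = (p, q) M\<close>.\<close>

fun s_param :: "s_coord \<Rightarrow> real^4^4" where
  "s_param (x, y, \<theta>, p, q, \<kappa>) =
     jacobi_matrix (iwasawa x y \<theta>) (vector [p, q] v* iwasawa x y \<theta>) (vector [p, q]) \<kappa>"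

text \<open>The components at \<open>u\<close> of a vector field \<open>X\<close> on the group: the coordinate vector that the
  derivative of the parametrization (injective for \<open>y > 0\<close>, see \<open>inj_s_param_derivative\<close>) sends to \<open>X\<close>.\<close>

definition in_s_coords :: "(real^4^4 \<Rightarrow> real^4^4) \<Rightarrow> s_coord \<Rightarrow> s_coord" where
  "in_s_coords X u = (THE \<xi>. frechet_derivative s_param (at u) \<xi> = X (s_param u))"

text \<open>The bracket of vector fields given by their components, normalized so that
  \<open>[X, Y] f = X (Y f) - Y (X f)\<close>.\<close>

definition lie_bracket :: "('v::real_normed_vector \<Rightarrow> 'v) \<Rightarrow> ('v \<Rightarrow> 'v) \<Rightarrow> 'v \<Rightarrow> 'v" where
  "lie_bracket X Y u = frechet_derivative Y (at u) (X u) - frechet_derivative X (at u) (Y u)"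


subsection \<open>The parametrization is an immersion onto the group\<close>

lemma vector_4_nth:
  "(vector [a,b,c,d] :: 'a::zero^4)$1 = a" "(vector [a,b,c,d] :: 'a::zero^4)$2 = b"
  "(vector [a,b,c,d] :: 'a::zero^4)$3 = c" "(vector [a,b,c,d] :: 'a::zero^4)$4 = d"
  by (simp_all add: vector_def)

lemma det_iwasawa: assumes "y > 0" shows "det (iwasawa x y \<theta>) = 1"
proof -
  have "(sqrt y * cos \<theta> - x / sqrt y * sin \<theta>) * (cos \<theta> / sqrt y) -
        (sqrt y * sin \<theta> + x / sqrt y * cos \<theta>) * (- sin \<theta> / sqrt y) = (cos \<theta>)\<^sup>2 + (sin \<theta>)\<^sup>2"
    using assms by (simp add: algebra_simps power2_eq_square)
  then show ?thesis by (simp add: det_2 iwasawa_def)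
qed

lemma iwasawa_surj:
  assumes "det M = 1" obtains x y \<theta> where "y > 0" "M = iwasawa x y \<theta>"
proof -
  define a b c d where "a = M$1$1" "b = M$1$2" "c = M$2$1" "d = M$2$2"
  note defs = this
  have det: "a * d - b * c = 1" using assms by (simp add: det_2 defs)
  define r where "r = sqrt (c\<^sup>2 + d\<^sup>2)"
  have "c \<noteq> 0 \<or> d \<noteq> 0" using det by auto
  then have pos: "c\<^sup>2 + d\<^sup>2 > 0" by (simp add: sum_power2_gt_zero_iff)
  then have r: "r > 0" "r\<^sup>2 = c\<^sup>2 + d\<^sup>2" by (auto simp: r_def)
  have "(d / r)\<^sup>2 + (- c / r)\<^sup>2 = (c\<^sup>2 + d\<^sup>2) / r\<^sup>2"
    by (simp add: power_divide add_divide_distrib)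
  then have "(d / r)\<^sup>2 + (- c / r)\<^sup>2 = 1" using r pos by auto
  then obtain \<theta> where t: "d / r = cos \<theta>" "- c / r = sin \<theta>" by (rule sincos_total_2pi)
  define y where "y = 1 / r\<^sup>2"
  define x where "x = (a * c + b * d) / r\<^sup>2"
  have y: "y > 0" "sqrt y = 1 / r" using r(1) by (simp_all add: y_def real_sqrt_divide)
  have c: "c = - r * sin \<theta>" and d: "d = r * cos \<theta>" using t r by (auto simp: field_simps)
  have a: "a = sqrt y * cos \<theta> - x / sqrt y * sin \<theta>"
  proof -
    have "a * r\<^sup>2 = d + (a * c + b * d) * c" using det r(2) by (simp add: power2_eq_square) algebra
    then have "a = (d + (a * c + b * d) * c) / r\<^sup>2" using r(1) by (simp add: field_simps)
    also have "\<dots> = sqrt y * cos \<theta> - x / sqrt y * sin \<theta>"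
      using r(1) by (simp add: y(2) x_def t[symmetric] power2_eq_square add_divide_distrib distrib_right)
    finally show ?thesis .
  qed
  have b: "b = sqrt y * sin \<theta> + x / sqrt y * cos \<theta>"
  proof -
    have "b * r\<^sup>2 = - c + (a * c + b * d) * d" using det r(2) by (simp add: power2_eq_square) algebra
    then have "b = (- c + (a * c + b * d) * d) / r\<^sup>2" using r(1) by (simp add: field_simps)
    also have "\<dots> = sqrt y * sin \<theta> + x / sqrt y * cos \<theta>"
      using r(1) by (simp add: y(2) x_def t[symmetric] power2_eq_square add_divide_distrib distrib_right diff_divide_distrib)
    finally show ?thesis .
  qed
  have "M = iwasawa x y \<theta>"
    using a b c d y r by (simp add: vec_eq_iff forall_2 iwasawa_def defs[symmetric])
  with y that show thesis by blast
qed

lemma matrix_inv_inverse: fixes A :: "real^'n^'n" assumes "invertible A"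
  shows "matrix_inv A ** A = mat 1" "A ** matrix_inv A = mat 1"
  using someI_ex[OF assms[unfolded invertible_def]] by (auto simp: matrix_inv_def)

lemma s_param_image: "s_param ` {(x, y, \<theta>, p, q, \<kappa>). y > 0} = jacobi_group"
proof (intro subset_antisym subsetI)
  fix g assume "g \<in> s_param ` {(x, y, \<theta>, p, q, \<kappa>). y > 0}"
  then obtain x y \<theta> p q \<kappa> where y: "y > 0" and g: "g = s_param (x, y, \<theta>, p, q, \<kappa>)" by auto
  let ?M = "iwasawa x y \<theta>"
  have M: "det ?M = 1" using y by (rule det_iwasawa)
  then have "?M ** matrix_inv ?M = mat 1"
    by (intro matrix_inv_inverse(2)) (simp add: invertible_det_nz)
  then have "vector [p, q] = (vector [p, q] v* ?M) v* matrix_inv ?M"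
    by (simp only: vector_matrix_mul_assoc vector_matrix_mul_rid)
  then show "g \<in> jacobi_group" unfolding jacobi_group_def g s_param.simps using M by blast
next
  fix g assume "g \<in> jacobi_group"
  then obtain M l w \<kappa> where M: "det M = 1" and w: "w = l v* matrix_inv M"
    and g: "g = jacobi_matrix M l w \<kappa>" by (auto simp: jacobi_group_def)
  obtain x y \<theta> where y: "y > 0" "M = iwasawa x y \<theta>" using M by (rule iwasawa_surj)
  have "matrix_inv M ** M = mat 1"
    using M by (intro matrix_inv_inverse(1)) (simp add: invertible_det_nz)
  then have l: "l = w v* M" unfolding w
    by (simp only: vector_matrix_mul_assoc vector_matrix_mul_rid)
  have "w = vector [w$1, w$2]" by (simp add: vec_eq_iff forall_2)
  then have "g = s_param (x, y, \<theta>, w$1, w$2, \<kappa>)" using g l y by simp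
  moreover have "(x, y, \<theta>, w$1, w$2, \<kappa>) \<in> {(x, y, \<theta>, p, q, \<kappa>). y > 0}" using y by simp
  ultimately show "g \<in> s_param ` {(x, y, \<theta>, p, q, \<kappa>). y > 0}" by (rule image_eqI)
qed

lemma matrix_has_derivative:
  fixes f :: "'a::real_normed_vector \<Rightarrow> real^'n^'m"
  assumes "\<And>i j. ((\<lambda>u. f u $ i $ j) has_derivative (\<lambda>h. f' h $ i $ j)) (at u)"
  shows "(f has_derivative f') (at u)"
  by (subst has_derivative_componentwise_within)
     (auto simp: Basis_vec_def inner_axis intro!: assms)

definition iwasawa_deriv :: "real \<Rightarrow> real \<Rightarrow> real \<Rightarrow> real \<times> real \<times> real \<Rightarrow> real^2^2" where
  "iwasawa_deriv x y \<theta> = (\<lambda>(hx, hy, ht).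
     vector [vector [(cos \<theta> / (2 * sqrt y) + x * sin \<theta> / (2 * y * sqrt y)) * hy
                      - sin \<theta> / sqrt y * hx - (sqrt y * sin \<theta> + x / sqrt y * cos \<theta>) * ht,
                     (sin \<theta> / (2 * sqrt y) - x * cos \<theta> / (2 * y * sqrt y)) * hy
                      + cos \<theta> / sqrt y * hx + (sqrt y * cos \<theta> - x / sqrt y * sin \<theta>) * ht],
             vector [sin \<theta> / (2 * y * sqrt y) * hy - cos \<theta> / sqrt y * ht,
                     - cos \<theta> / (2 * y * sqrt y) * hy - sin \<theta> / sqrt y * ht]])"

lemma iwasawa_has_derivative:
  fixes x y \<theta> :: real and w :: "real \<times> real \<times> real"
  assumes y: "y > 0"
  shows "((\<lambda>(x, y, \<theta>, w). iwasawa x y \<theta>) has_derivative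
          (\<lambda>(hx, hy, ht, hw). iwasawa_deriv x y \<theta> (hx, hy, ht))) (at (x, y, \<theta>, w))"
proof (unfold case_prod_unfold, rule matrix_has_derivative)
  fix i j :: 2
  let ?u = "(x, y, \<theta>, w)"
  let ?x = "\<lambda>v :: real \<times> real \<times> real \<times> real \<times> real \<times> real. fst v"
    and ?y = "\<lambda>v :: real \<times> real \<times> real \<times> real \<times> real \<times> real. fst (snd v)"
    and ?t = "\<lambda>v :: real \<times> real \<times> real \<times> real \<times> real \<times> real. fst (snd (snd v))"
  have sin: "((\<lambda>v. sin (?t v)) has_derivative (\<lambda>h. cos \<theta> * ?t h)) (at ?u)"
    and cos: "((\<lambda>v. cos (?t v)) has_derivative (\<lambda>h. - sin \<theta> * ?t h)) (at ?u)"
    by (auto intro!: derivative_eq_intros simp: mult.commute)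
  have root: "((\<lambda>v. sqrt (?y v)) has_derivative (\<lambda>h. ?y h / (2 * sqrt y))) (at ?u)"
    using y by (auto intro!: derivative_eq_intros simp: fun_eq_iff field_simps)
  have root_inv: "((\<lambda>v. 1 / sqrt (?y v)) has_derivative (\<lambda>h. - ?y h / (2 * y * sqrt y))) (at ?u)"
    using y by (auto intro!: derivative_eq_intros simp: fun_eq_iff field_simps)
  have x: "(?x has_derivative ?x) (at ?u)"
    by (auto intro!: derivative_eq_intros)
  note intros = has_derivative_add has_derivative_diff has_derivative_minus has_derivative_mult
    sin cos root root_inv x
  have 11: "((\<lambda>v. sqrt (?y v) * cos (?t v) - ?x v * (1 / sqrt (?y v)) * sin (?t v)) has_derivative
    (\<lambda>h. iwasawa_deriv x y \<theta> (?x h, ?y h, ?t h) $ 1 $ 1)) (at ?u)"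
    by (rule has_derivative_eq_rhs, (rule intros)+)
       (simp add: iwasawa_deriv_def fun_eq_iff algebra_simps)
  have 12: "((\<lambda>v. sqrt (?y v) * sin (?t v) + ?x v * (1 / sqrt (?y v)) * cos (?t v)) has_derivative
    (\<lambda>h. iwasawa_deriv x y \<theta> (?x h, ?y h, ?t h) $ 1 $ 2)) (at ?u)"
    by (rule has_derivative_eq_rhs, (rule intros)+)
       (simp add: iwasawa_deriv_def fun_eq_iff algebra_simps)
  have 21: "((\<lambda>v. - sin (?t v) * (1 / sqrt (?y v))) has_derivative
    (\<lambda>h. iwasawa_deriv x y \<theta> (?x h, ?y h, ?t h) $ 2 $ 1)) (at ?u)"
    by (rule has_derivative_eq_rhs, (rule intros)+)
       (simp add: iwasawa_deriv_def fun_eq_iff algebra_simps)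
  have 22: "((\<lambda>v. cos (?t v) * (1 / sqrt (?y v))) has_derivative
    (\<lambda>h. iwasawa_deriv x y \<theta> (?x h, ?y h, ?t h) $ 2 $ 2)) (at ?u)"
    by (rule has_derivative_eq_rhs, (rule intros)+)
       (simp add: iwasawa_deriv_def fun_eq_iff algebra_simps)
  show "((\<lambda>v. iwasawa (?x v) (?y v) (?t v) $ i $ j) has_derivative
    (\<lambda>h. iwasawa_deriv x y \<theta> (?x h, ?y h, ?t h) $ i $ j)) (at ?u)"
    using exhaust_2[of i] exhaust_2[of j] 11 12 21 22
    by (elim disjE) (simp_all add: iwasawa_def)
qed

definition s_param_deriv :: "s_coord \<Rightarrow> s_coord \<Rightarrow> real^4^4" where
  "s_param_deriv = (\<lambda>(x, y, \<theta>, p, q, \<kappa>) (hx, hy, ht, hp, hq, hk).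
     let M = iwasawa x y \<theta>; D = iwasawa_deriv x y \<theta> (hx, hy, ht) in
     vector [vector [D$1$1, 0, D$1$2, hq],
             vector [hp * M$1$1 + p * D$1$1 + hq * M$2$1 + q * D$2$1, 0,
                     hp * M$1$2 + p * D$1$2 + hq * M$2$2 + q * D$2$2, hk],
             vector [D$2$1, 0, D$2$2, - hp],
             vector [0, 0, 0, 0]])"

lemma s_param_has_derivative:
  fixes x y \<theta> p q \<kappa> :: real
  assumes y: "y > 0"
  defines "u \<equiv> (x, y, \<theta>, p, q, \<kappa>)"
  shows "(s_param has_derivative s_param_deriv u) (at u)"
proof (rule matrix_has_derivative)
  fix i j :: 4
  define M where "M = (\<lambda>(x, y, \<theta>, w :: real \<times> real \<times> real). iwasawa x y \<theta>)"
  define D where "D = (\<lambda>(hx, hy, ht, hw :: real \<times> real \<times> real). iwasawa_deriv x y \<theta> (hx, hy, ht))"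
  have "(M has_derivative D) (at u)"
    unfolding M_def D_def u_def using y by (rule iwasawa_has_derivative)
  then have M: "((\<lambda>v. M v $ i $ j) has_derivative (\<lambda>h. D h $ i $ j)) (at u)" for i j
    by (intro bounded_linear.has_derivative[OF bounded_linear_vec_nth])
  have Mu: "M u = iwasawa x y \<theta>" by (simp add: M_def u_def)
  have S: "s_param = (\<lambda>v. let p = fst (snd (snd (snd v))); q = fst (snd (snd (snd (snd v)))) in
     vector [vector [M v$1$1, 0, M v$1$2, q],
             vector [p * M v$1$1 + q * M v$2$1, 1, p * M v$1$2 + q * M v$2$2,
                     snd (snd (snd (snd (snd v))))],
             vector [M v$2$1, 0, M v$2$2, - p],
             vector [0, 0, 0, 1]])"
    by (auto simp: fun_eq_iff M_def jacobi_matrix_def vector_matrix_mult_def sum_2 mult.commute)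
  have D: "s_param_deriv u = (\<lambda>h. let hp = fst (snd (snd (snd h))); hq = fst (snd (snd (snd (snd h)))) in
     vector [vector [D h$1$1, 0, D h$1$2, hq],
             vector [hp * M u$1$1 + p * D h$1$1 + hq * M u$2$1 + q * D h$2$1, 0,
                     hp * M u$1$2 + p * D h$1$2 + hq * M u$2$2 + q * D h$2$2,
                     snd (snd (snd (snd (snd h))))],
             vector [D h$2$1, 0, D h$2$2, - hp],
             vector [0, 0, 0, 0]])"
    by (auto simp: fun_eq_iff D_def Mu[unfolded u_def] s_param_deriv_def u_def Let_def)
  have u: "fst (snd (snd (snd u))) = p" "fst (snd (snd (snd (snd u)))) = q" by (auto simp: u_def)
  show "((\<lambda>v. s_param v $ i $ j) has_derivative (\<lambda>h. s_param_deriv u h $ i $ j)) (at u)"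
    unfolding S D Let_def using exhaust_4[of i] exhaust_4[of j]
    by (elim disjE; simp add: vector_4_nth del: One_nat_def;
        auto intro!: derivative_eq_intros M simp: u algebra_simps)
qed

lemma inj_s_param_derivative:
  fixes x y \<theta> p q \<kappa> :: real
  assumes y: "y > 0"
  shows "inj (frechet_derivative s_param (at (x, y, \<theta>, p, q, \<kappa>)))"
proof -
  let ?u = "(x, y, \<theta>, p, q, \<kappa>)" and ?s = "sqrt y"
  note S = s_param_has_derivative[OF y, of x \<theta> p q \<kappa>]
  have "h = 0" if "s_param_deriv ?u h = 0" for h
  proof -
    obtain hx hy ht hp hq hk where h: "h = (hx, hy, ht, hp, hq, hk)" by (cases h)
    let ?D = "iwasawa_deriv x y \<theta> (hx, hy, ht)"
    have "s_param_deriv ?u h $ i $ j = 0" for i j using that by simp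
    from this[of 1 4] this[of 3 4] this[of 2 4] this[of 1 1] this[of 1 3] this[of 3 1] this[of 3 3]
    have 0: "hp = 0" "hq = 0" "hk = 0"
      and D: "?D$1$1 = 0" "?D$1$2 = 0" "?D$2$1 = 0" "?D$2$2 = 0"
      by (auto simp: s_param_deriv_def h vector_4_nth Let_def)
    have sc: "sin \<theta> * sin \<theta> + cos \<theta> * cos \<theta> = 1" by (simp add: power2_eq_square[symmetric])
    have "sin \<theta> * ?D$2$1 - cos \<theta> * ?D$2$2 = sin \<theta> * sin \<theta> * (hy / (2 * y * ?s)) + cos \<theta> * cos \<theta> * (hy / (2 * y * ?s))"
      by (simp add: iwasawa_deriv_def algebra_simps add_divide_distrib)
    also have "\<dots> = hy / (2 * y * ?s)" by (simp only: distrib_right[symmetric] sc mult_1)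
    finally have hy: "hy = 0" using D y by simp
    have "- cos \<theta> * ?D$2$1 - sin \<theta> * ?D$2$2 = sin \<theta> * sin \<theta> * (ht / ?s) + cos \<theta> * cos \<theta> * (ht / ?s)"
      by (simp add: iwasawa_deriv_def algebra_simps add_divide_distrib)
    also have "\<dots> = ht / ?s" by (simp only: distrib_right[symmetric] sc mult_1)
    finally have ht: "ht = 0" using D y by simp
    have "cos \<theta> * ?D$1$2 - sin \<theta> * ?D$1$1 = sin \<theta> * sin \<theta> * (hx / ?s) + cos \<theta> * cos \<theta> * (hx / ?s)"
      by (simp add: iwasawa_deriv_def algebra_simps add_divide_distrib hy ht)
    also have "\<dots> = hx / ?s" by (simp only: distrib_right[symmetric] sc mult_1)
    finally have "hx = 0" using D y by simp
    with 0 hy ht h show ?thesis by (simp add: zero_prod_def)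
  qed
  then show ?thesis
    unfolding frechet_derivative_at[OF S, symmetric]
    using linear_injective_0[OF has_derivative_linear[OF S]] by blast
qed

end

theory Submission
  imports Defs
begin

text \<open>A matrix belongs to the Jacobi group exactly when it preserves the standard symplectic form on
  \<open>\<real>\<^sup>4\<close>, whose hyperbolic pairs are \<open>e\<^sub>1, e\<^sub>3\<close> and \<open>e\<^sub>2, e\<^sub>4\<close>, and fixes the vector \<open>e\<^sub>2\<close>
  (\<open>jacobi_group_iff_symplectic\<close>). This makes the group law evident. Differentiating the two conditions
  along a curve shows that \<open>g\<^sup>-\<^sup>1 v\<close>, for a tangent vector \<open>v\<close> at \<open>g\<close>, is an infinitesimal symplectic
  matrix that annihilates \<open>e\<^sub>2\<close>, and such matrices are the linear combinations of the six generators
  (\<open>tangent_vector_in_jacobi_algebra\<close>). As the generators are linearly independent, the one-forms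
  are well defined on tangent vectors, and the only candidate for the dual field \<open>L\<^sup>A\<close> is
  \<open>g \<mapsto> g A\<close>, for each generator \<open>A\<close>. Left invariance of forms and fields is then associativity of the
  matrix product.

  The coordinate formulas need no inversion of a Jacobian: it suffices that the derivative of the
  parametrization sends the claimed components to \<open>g A\<close> (\<open>s_param_deriv_s_field\<close>), because it is
  injective. The core of this is the same statement for the Iwasawa
  parametrization of \<open>SL(2,\<real>)\<close> (\<open>iwasawa_deriv_s_field\<close>). The same calculation provides tangency:
  the image under the parametrization of a straight line in coordinate space is a curve in the group with
  velocity \<open>g A\<close>.

  The brackets are computed in coordinates. The components of \<open>L\<^sup>F, L\<^sup>G, L\<^sup>H\<close> depend on \<open>y, \<theta>\<close> only,
  through \<open>y\<close>, \<open>cos 2\<theta>\<close> and \<open>sin 2\<theta>\<close>. Those of \<open>L\<^sup>P\<close> and \<open>L\<^sup>Q\<close> are expressions in the entries of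
  the Iwasawa matrix \<open>M\<close>, whose derivatives along the first three fields are the entries of \<open>M X\<close> for the
  \<open>2\<times>2\<close> block \<open>X\<close> of the generator. This leaves polynomial identities, with
  \<open>det M = 1\<close> needed only for \<open>[L\<^sup>P, L\<^sup>Q]\<close>.\<close>

section \<open>Matrix algebra\<close>

lemma bounded_bilinear_matrix_matrix_mult:
  "bounded_bilinear ((**) :: real^'n^'m \<Rightarrow> real^'p^'n \<Rightarrow> real^'p^'m)"
proof -
  have "bilinear ((**) :: real^'n^'m \<Rightarrow> real^'p^'n \<Rightarrow> real^'p^'m)"
    by (auto simp: bilinear_def linear_iff vec_eq_iff matrix_matrix_mult_def sum.distrib
        sum_distrib_left algebra_simps)
  then show ?thesis by (simp add: bilinear_conv_bounded_bilinear)
qed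

interpretation matrix_mult: bounded_bilinear "(**) :: real^'n^'m \<Rightarrow> real^'p^'n \<Rightarrow> real^'p^'m"
  by (rule bounded_bilinear_matrix_matrix_mult)

lemma bounded_linear_transpose: "bounded_linear (transpose :: real^'n^'m \<Rightarrow> real^'m^'n)"
  by (auto simp: linear_conv_bounded_linear[symmetric] linear_iff vec_eq_iff transpose_def)

lemma bounded_linear_column: "bounded_linear (column i :: real^'n^'m \<Rightarrow> real^'m)"
  by (auto simp: linear_conv_bounded_linear[symmetric] linear_iff vec_eq_iff column_def)

lemma column_matrix_mult: "column j (A ** B) = A *v column j B"
  by (simp add: vec_eq_iff column_def matrix_matrix_mult_def matrix_vector_mult_def)

lemma E_nth: "E i j $ k $ l = (if k = i \<and> l = j then 1 else 0)"
  by (auto simp: E_def axis_def)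

lemma E_mult: "E i j ** E k l = (if j = k then E i l else 0)"
  by (auto simp: vec_eq_iff matrix_matrix_mult_def E_nth if_distrib[of "\<lambda>c. c * _"] cong: if_cong)

section \<open>The Jacobi group as a stabilizer in the symplectic group\<close>

text \<open>The hyperbolic pairs are \<open>e\<^sub>1, e\<^sub>3\<close> and \<open>e\<^sub>2, e\<^sub>4\<close>, not the consecutive ones: the
  group embeds \<open>SL(2,\<real>)\<close> in the rows and columns \<open>1, 3\<close>.\<close>

definition symplectic_form :: "real^4^4" where
  "symplectic_form = E 1 3 - E 3 1 + E 2 4 - E 4 2"

lemma symplectic_form_square: "symplectic_form ** symplectic_form = - mat 1"
  by (simp add: vec_eq_iff forall_4 symplectic_form_def matrix_matrix_mult_def sum_4 E_nth mat_def)

text \<open>The same parameters with \<open>(p, q)\<close> independent and \<open>(\<lambda>, \<mu>) = (p, q) M\<close> computed from it, which removes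
  the matrix inverse from entrywise calculations.\<close>

lemma jacobi_group_alt:
  "g \<in> jacobi_group \<longleftrightarrow> (\<exists>M w \<kappa>. det M = 1 \<and> g = jacobi_matrix M (w v* M) w \<kappa>)"
proof -
  have *: "w = l v* matrix_inv M \<longleftrightarrow> l = w v* M" if "det M = 1" for M :: "real^2^2" and l w
  proof -
    have "invertible M" using that by (simp add: invertible_det_nz)
    then show ?thesis
      using matrix_inv_inverse[of M] by (metis vector_matrix_mul_assoc vector_matrix_mul_rid)
  qed
  have "g = jacobi_matrix M l w \<kappa> \<and> det M = 1 \<and> w = l v* matrix_inv M \<longleftrightarrow>
      g = jacobi_matrix M l w \<kappa> \<and> det M = 1 \<and> l = w v* M" for M l w \<kappa>
    using *[of M w l] by blast
  then have "g \<in> jacobi_group \<longleftrightarrow> (\<exists>M l w \<kappa>. g = jacobi_matrix M l w \<kappa> \<and> det M = 1 \<and> l = w v* M)"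
    unfolding jacobi_group_def by (simp only: mem_Collect_eq)
  then show ?thesis by blast
qed

text \<open>The symplectic conditions on the columns \<open>g e\<^sub>1, g e\<^sub>3\<close> say that the \<open>2\<times>2\<close> block has determinant
  one, those on \<open>g e\<^sub>1, g e\<^sub>4\<close> and \<open>g e\<^sub>3, g e\<^sub>4\<close> say that \<open>(\<lambda>, \<mu>) = (p, q) M\<close>. As \<open>g\<close> fixes \<open>e\<^sub>2\<close>, it
  preserves the pairing with \<open>e\<^sub>2\<close>, which is the fourth coordinate, so its last row is that of the
  identity.\<close>

lemma jacobi_group_iff_symplectic:
  "g \<in> jacobi_group \<longleftrightarrow>
     transpose g ** symplectic_form ** g = symplectic_form \<and> column 2 g = axis 2 1"
   (is "_ \<longleftrightarrow> ?S \<and> ?C")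
proof
  assume "g \<in> jacobi_group"
  then obtain M w \<kappa> where M: "det M = 1" and g: "g = jacobi_matrix M (w v* M) w \<kappa>"
    by (auto simp: jacobi_group_alt)
  have det: "M$1$1 * M$2$2 = 1 + M$1$2 * M$2$1" using M by (simp add: det_2)
  show "?S \<and> ?C"
    unfolding g
    by (simp add: vec_eq_iff forall_4 symplectic_form_def transpose_def matrix_matrix_mult_def sum_4
      sum_2 E_nth jacobi_matrix_def vector_4_nth vector_matrix_mult_def column_def axis_def;
     use det in algebra)
next
  assume gg: "?S \<and> ?C"
  define M :: "real^2^2" where "M = vector [vector [g$1$1, g$1$3], vector [g$3$1, g$3$3]]"
  define w :: "real^2" where "w = vector [- g$3$4, g$1$4]"
  have "det M = 1 \<and> g = jacobi_matrix M (w v* M) w (g$2$4)"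
    using gg
    by (simp add: vec_eq_iff forall_4 symplectic_form_def transpose_def matrix_matrix_mult_def sum_4
      sum_2 E_nth jacobi_matrix_def vector_4_nth vector_matrix_mult_def det_2 column_def axis_def M_def w_def;
     auto simp: algebra_simps)
  then show "g \<in> jacobi_group" unfolding jacobi_group_alt by blast
qed

lemma invertible_jacobi_group: assumes "g \<in> jacobi_group" shows "invertible g"
proof -
  \<comment> \<open>the inverse of a matrix that preserves the form \<open>J\<close>, where \<open>J\<^sup>2 = -1\<close>\<close>
  have "- symplectic_form ** transpose g ** symplectic_form ** g = mat 1"
    using assms by (simp add: jacobi_group_iff_symplectic matrix_mul_assoc[symmetric]
      matrix_mult.minus_left symplectic_form_square)
  then show ?thesis unfolding invertible_left_inverse by blast
qed

lemma jacobi_group_mult_closed: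
  assumes g: "g \<in> jacobi_group" and h: "h \<in> jacobi_group" shows "h ** g \<in> jacobi_group"
proof -
  have "transpose (h ** g) ** symplectic_form ** (h ** g)
      = transpose g ** (transpose h ** symplectic_form ** h) ** g"
    by (simp only: matrix_transpose_mul matrix_mul_assoc)
  moreover have "column 2 (h ** g) = column 2 h"
    using g by (simp add: column_matrix_mult jacobi_group_iff_symplectic matrix_vector_mult_basis)
  ultimately show ?thesis using g h by (simp add: jacobi_group_iff_symplectic)
qed

section \<open>The tangent spaces\<close>

lemma sum_gen_matrix:
  fixes c :: "jacobi_gen \<Rightarrow> real"
  shows "(\<Sum>B\<in>UNIV. c B *\<^sub>R gen B) =
     vector [vector [c GenH, 0, c GenF, c GenQ],
             vector [c GenP, 0, c GenQ, c GenR],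
             vector [c GenG, 0, - c GenH, - c GenP],
             vector [0, 0, 0, 0]]"
  by (simp add: UNIV_jacobi_gen vec_eq_iff forall_4 E_nth vector_4_nth)

lemma gen_independent:
  assumes "(\<Sum>B\<in>UNIV. c B *\<^sub>R gen B) = (\<Sum>B\<in>UNIV. c' B *\<^sub>R gen B)"
  shows "c = c'"
proof
  fix A show "c A = c' A"
    using assms by (cases A) (simp_all add: sum_gen_matrix vec_eq_iff forall_4 vector_4_nth)
qed

text \<open>The infinitesimal version of \<open>jacobi_group_iff_symplectic\<close>: it turns the description of the Lie
  algebra by a basis into one by equations, which is what differentiation of curves delivers.\<close>

lemma jacobi_algebra_iff_symplectic:
  "(\<exists>c. X = (\<Sum>B\<in>UNIV. c B *\<^sub>R gen B)) \<longleftrightarrow>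
     transpose X ** symplectic_form + symplectic_form ** X = 0 \<and> column 2 X = 0"
  (is "_ \<longleftrightarrow> ?S \<and> ?C")
proof
  assume "\<exists>c. X = (\<Sum>B\<in>UNIV. c B *\<^sub>R gen B)"
  then obtain c where X: "X = (\<Sum>B\<in>UNIV. c B *\<^sub>R gen B)" ..
  show "?S \<and> ?C" unfolding X sum_gen_matrix
    by (simp add: vec_eq_iff forall_4 symplectic_form_def transpose_def matrix_matrix_mult_def sum_4
      E_nth vector_4_nth column_def)
next
  assume *: "?S \<and> ?C"
  have "X$i$2 = 0" for i using * by (auto simp: vec_eq_iff column_def)
  moreover have "(transpose X ** symplectic_form + symplectic_form ** X)$i$j = 0" for i j
    using * by simp
  \<comment> \<open>the matrix \<open>X\<^sup>T J + J X\<close> is antisymmetric, so the entries above the diagonal suffice\<close>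
  note this[of 1 2] this[of 1 3] this[of 1 4] this[of 2 3] this[of 2 4] this[of 3 4]
  ultimately have entries: "X$1$2 = 0" "X$2$2 = 0" "X$3$2 = 0" "X$4$2 = 0"
    "X$4$1 = 0" "X$4$3 = 0" "X$4$4 = 0" "X$3$3 = - X$1$1" "X$3$4 = - X$2$1" "X$2$3 = X$1$4"
    by (simp_all add: symplectic_form_def transpose_def matrix_matrix_mult_def sum_4 E_nth)
  define c where "c = case_jacobi_gen (X$1$3) (X$3$1) (X$1$1) (X$2$1) (X$1$4) (X$2$4)"
  have "X = (\<Sum>B\<in>UNIV. c B *\<^sub>R gen B)" unfolding sum_gen_matrix
    by (simp add: vec_eq_iff forall_4 vector_4_nth entries c_def)
  then show "\<exists>c. X = (\<Sum>B\<in>UNIV. c B *\<^sub>R gen B)" by (rule exI[of _ c])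
qed

text \<open>The equations that define the group are constant along a curve in it, so their derivatives
  vanish. Substituting \<open>v = g X\<close> and using once more that \<open>g\<close> is symplectic leaves the equations of the
  Lie algebra for \<open>X\<close>.\<close>

lemma tangent_vector_in_jacobi_algebra:
  assumes g: "g \<in> jacobi_group" and v: "v \<in> tangent_space jacobi_group g"
  shows "\<exists>c. v = g ** (\<Sum>B\<in>UNIV. c B *\<^sub>R gen B)"
proof -
  obtain \<gamma> \<epsilon> where "\<epsilon> > 0" and G: "\<And>t. \<bar>t\<bar> < \<epsilon> \<Longrightarrow> \<gamma> t \<in> jacobi_group" and \<gamma>0: "\<gamma> 0 = g"
    and d: "(\<gamma> has_vector_derivative v) (at 0)"
    using v unfolding tangent_space_def by auto
  have open_interval: "open {-\<epsilon><..<\<epsilon>}" "0 \<in> {-\<epsilon><..<\<epsilon>}" using \<open>\<epsilon> > 0\<close> by auto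
  have S: "transpose v ** symplectic_form ** g + transpose g ** symplectic_form ** v = 0"
  proof (rule vector_derivative_unique_at)
    show "((\<lambda>t. transpose (\<gamma> t) ** symplectic_form ** \<gamma> t) has_vector_derivative
        transpose v ** symplectic_form ** g + transpose g ** symplectic_form ** v) (at 0)"
      using matrix_mult.has_vector_derivative[OF matrix_mult.has_vector_derivative[OF
          bounded_linear.has_vector_derivative[OF bounded_linear_transpose d]
          has_vector_derivative_const] d]
      by (simp add: \<gamma>0 add.commute)
    show "((\<lambda>t. transpose (\<gamma> t) ** symplectic_form ** \<gamma> t) has_vector_derivative 0) (at 0)"
      by (rule has_vector_derivative_transform_within_open[OF
          has_vector_derivative_const[of symplectic_form] open_interval])
         (use G in \<open>auto simp: jacobi_group_iff_symplectic\<close>)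
  qed
  have C: "column 2 v = 0"
  proof (rule vector_derivative_unique_at)
    show "((\<lambda>t. column 2 (\<gamma> t)) has_vector_derivative column 2 v) (at 0)"
      by (rule bounded_linear.has_vector_derivative[OF bounded_linear_column d])
    show "((\<lambda>t. column 2 (\<gamma> t)) has_vector_derivative 0) (at 0)"
      by (rule has_vector_derivative_transform_within_open[OF
          has_vector_derivative_const[of "axis 2 1"] open_interval])
         (use G in \<open>auto simp: jacobi_group_iff_symplectic\<close>)
  qed
  define X where "X = matrix_inv g ** v"
  have gX: "v = g ** X" using matrix_inv_inverse(2)[OF invertible_jacobi_group[OF g]]
    by (simp add: X_def matrix_mul_assoc)
  have gS: "transpose g ** symplectic_form ** g = symplectic_form"
    using g by (simp add: jacobi_group_iff_symplectic)
  have "transpose v ** symplectic_form ** g = transpose X ** (transpose g ** symplectic_form ** g)"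
       "transpose g ** symplectic_form ** v = (transpose g ** symplectic_form ** g) ** X"
    by (simp_all only: gX matrix_transpose_mul matrix_mul_assoc)
  then have "transpose X ** symplectic_form + symplectic_form ** X = 0" using S gS by simp
  moreover have "column 2 X = 0" by (simp add: X_def column_matrix_mult C)
  ultimately show ?thesis using jacobi_algebra_iff_symplectic[of X] gX by blast
qed

section \<open>The fields in S-coordinates\<close>

text \<open>The components of the six fields that the coordinate formulas claim; \<open>in_s_coords_left_field\<close> shows
  that they are right. For \<open>P\<close> and \<open>Q\<close> the entries of \<open>M\<close> are kept, as their derivatives along the
  fields are simple.\<close>

fun s_field :: "jacobi_gen \<Rightarrow> s_coord \<Rightarrow> s_coord" where
  "s_field GenF (x, y, \<theta>, p, q, \<kappa>) = (y * cos (2 * \<theta>), y * sin (2 * \<theta>), (sin \<theta>)\<^sup>2, 0, 0, 0)"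
| "s_field GenG (x, y, \<theta>, p, q, \<kappa>) = (y * cos (2 * \<theta>), y * sin (2 * \<theta>), - (cos \<theta>)\<^sup>2, 0, 0, 0)"
| "s_field GenH (x, y, \<theta>, p, q, \<kappa>) =
     (- 2 * y * sin (2 * \<theta>), 2 * y * cos (2 * \<theta>), sin (2 * \<theta>), 0, 0, 0)"
| "s_field GenP (x, y, \<theta>, p, q, \<kappa>) =
     (let M = iwasawa x y \<theta> in (0, 0, 0, M$2$2, - M$1$2, - (p * M$1$2 + q * M$2$2)))"
| "s_field GenQ (x, y, \<theta>, p, q, \<kappa>) =
     (let M = iwasawa x y \<theta> in (0, 0, 0, - M$2$1, M$1$1, p * M$1$1 + q * M$2$1))"
| "s_field GenR (x, y, \<theta>, p, q, \<kappa>) = (0, 0, 0, 0, 0, 1)"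

text \<open>Projected to \<open>SL(2,\<real>)\<close>, a left-invariant field moves \<open>M\<close> with velocity \<open>M X\<close>, where \<open>X\<close> is the
  block of its generator in the rows and columns \<open>1, 3\<close>; this block vanishes for \<open>P, Q, R\<close>. After
  the substitution \<open>y = r\<^sup>2\<close> each entry is a polynomial identity modulo \<open>cos\<^sup>2 \<theta> + sin\<^sup>2 \<theta> = 1\<close>.\<close>

lemma iwasawa_deriv_s_field:
  assumes y: "y > 0"
  shows "iwasawa_deriv x y \<theta> (y * cos (2 * \<theta>), y * sin (2 * \<theta>), (sin \<theta>)\<^sup>2) =
           iwasawa x y \<theta> ** vector [vector [0, 1], vector [0, 0]]"
    and "iwasawa_deriv x y \<theta> (y * cos (2 * \<theta>), y * sin (2 * \<theta>), - (cos \<theta>)\<^sup>2) =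
           iwasawa x y \<theta> ** vector [vector [0, 0], vector [1, 0]]"
    and "iwasawa_deriv x y \<theta> (- 2 * y * sin (2 * \<theta>), 2 * y * cos (2 * \<theta>), sin (2 * \<theta>)) =
           iwasawa x y \<theta> ** vector [vector [1, 0], vector [0, - 1]]"
    and "iwasawa_deriv x y \<theta> (0, 0, 0) = 0"
proof -
  define r s c where "r = sqrt y" "s = sin \<theta>" "c = cos \<theta>"
  note rsc = this
  have r: "r > 0" "y = r * r" using y by (auto simp: rsc)
  have r0: "r \<noteq> 0" using r(1) by simp
  have sc: "s * s + c * c = 1" by (simp add: rsc power2_eq_square[symmetric])
  have sr: "sqrt (r * r) = r" using r by simp
  have tr: "sin (2 * \<theta>) = 2 * s * c" "cos (2 * \<theta>) = c * c - s * s"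
    by (simp_all add: rsc sin_double cos_double power2_eq_square)
  note simps = abs_of_pos[OF r(1)] vec_eq_iff forall_2 iwasawa_deriv_def iwasawa_def matrix_matrix_mult_def sum_2
     tr rsc(2,3)[symmetric] r(2) power2_eq_square sr
  show "iwasawa_deriv x y \<theta> (y * cos (2 * \<theta>), y * sin (2 * \<theta>), (sin \<theta>)\<^sup>2) =
           iwasawa x y \<theta> ** vector [vector [0, 1], vector [0, 0]]"
    by (simp add: simps; simp add: field_simps r(1) r0; intro conjI; use sc in algebra)
  show "iwasawa_deriv x y \<theta> (y * cos (2 * \<theta>), y * sin (2 * \<theta>), - (cos \<theta>)\<^sup>2) =
           iwasawa x y \<theta> ** vector [vector [0, 0], vector [1, 0]]"
    by (simp add: simps; simp add: field_simps r(1) r0; intro conjI; use sc in algebra)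
  show "iwasawa_deriv x y \<theta> (- 2 * y * sin (2 * \<theta>), 2 * y * cos (2 * \<theta>), sin (2 * \<theta>)) =
           iwasawa x y \<theta> ** vector [vector [1, 0], vector [0, - 1]]"
    by (simp add: simps; simp add: field_simps r(1) r0; intro conjI; use sc in algebra)
  show "iwasawa_deriv x y \<theta> (0, 0, 0) = 0"
    by (simp add: vec_eq_iff forall_2 iwasawa_deriv_def)
qed

text \<open>For \<open>F, G, H\<close> the velocity of \<open>(p, q) M\<close> is \<open>(p, q) M X\<close> as \<open>p, q\<close> stay constant. For \<open>P, Q\<close>
  the matrix \<open>M\<close> stays constant, and \<open>(\<lambda>, \<mu>) = (p, q) M\<close> has a constant velocity,
  \<open>(1, 0)\<close> or \<open>(0, 1)\<close>, because \<open>det M = 1\<close>.\<close>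

lemma s_param_deriv_s_field:
  fixes x y \<theta> p q \<kappa> :: real
  assumes y: "y > 0"
  defines "u \<equiv> (x, y, \<theta>, p, q, \<kappa>)"
  shows "s_param_deriv u (s_field A u) = s_param u ** gen A"
proof -
  have det: "iwasawa x y \<theta>$1$1 * iwasawa x y \<theta>$2$2 = 1 + iwasawa x y \<theta>$1$2 * iwasawa x y \<theta>$2$1"
    using det_iwasawa[OF y, of x \<theta>] by (simp add: det_2)
  show ?thesis
    by (cases A; simp add: u_def s_param_deriv_def Let_def jacobi_matrix_def vec_eq_iff forall_4
        matrix_matrix_mult_def sum_4 sum_2 E_nth vector_4_nth vector_matrix_mult_def
        iwasawa_deriv_s_field[OF y, simplified]; use det in \<open>simp add: algebra_simps\<close>)
qed

text \<open>The derivative of the Iwasawa matrix is left unexpanded: in the brackets it is evaluated on the fields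
  only, where \<open>iwasawa_deriv_s_field\<close> applies.\<close>

fun s_field_deriv :: "jacobi_gen \<Rightarrow> s_coord \<Rightarrow> s_coord \<Rightarrow> s_coord" where
  "s_field_deriv GenF (x, y, \<theta>, p, q, \<kappa>) (hx, hy, ht, hp, hq, hk) =
     (hy * cos (2 * \<theta>) - 2 * y * sin (2 * \<theta>) * ht, hy * sin (2 * \<theta>) + 2 * y * cos (2 * \<theta>) * ht,
      sin (2 * \<theta>) * ht, 0, 0, 0)"
| "s_field_deriv GenG (x, y, \<theta>, p, q, \<kappa>) (hx, hy, ht, hp, hq, hk) =
     (hy * cos (2 * \<theta>) - 2 * y * sin (2 * \<theta>) * ht, hy * sin (2 * \<theta>) + 2 * y * cos (2 * \<theta>) * ht,
      sin (2 * \<theta>) * ht, 0, 0, 0)"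
| "s_field_deriv GenH (x, y, \<theta>, p, q, \<kappa>) (hx, hy, ht, hp, hq, hk) =
     (- 2 * hy * sin (2 * \<theta>) - 4 * y * cos (2 * \<theta>) * ht,
      2 * hy * cos (2 * \<theta>) - 4 * y * sin (2 * \<theta>) * ht, 2 * cos (2 * \<theta>) * ht, 0, 0, 0)"
| "s_field_deriv GenP (x, y, \<theta>, p, q, \<kappa>) (hx, hy, ht, hp, hq, hk) =
     (let M = iwasawa x y \<theta>; D = iwasawa_deriv x y \<theta> (hx, hy, ht)
      in (0, 0, 0, D$2$2, - D$1$2, - (hp * M$1$2 + p * D$1$2 + hq * M$2$2 + q * D$2$2)))"
| "s_field_deriv GenQ (x, y, \<theta>, p, q, \<kappa>) (hx, hy, ht, hp, hq, hk) =
     (let M = iwasawa x y \<theta>; D = iwasawa_deriv x y \<theta> (hx, hy, ht)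
      in (0, 0, 0, - D$2$1, D$1$1, hp * M$1$1 + p * D$1$1 + hq * M$2$1 + q * D$2$1))"
| "s_field_deriv GenR (x, y, \<theta>, p, q, \<kappa>) (hx, hy, ht, hp, hq, hk) = 0"

lemma s_field_has_derivative:
  fixes x y \<theta> p q \<kappa> :: real
  assumes y: "y > 0"
  defines "u \<equiv> (x, y, \<theta>, p, q, \<kappa>)"
  shows "(s_field A has_derivative s_field_deriv A u) (at u)"
proof -
  define M where "M = (\<lambda>(x, y, \<theta>, w :: real \<times> real \<times> real). iwasawa x y \<theta>)"
  define D where "D = (\<lambda>(hx, hy, ht, hw :: real \<times> real \<times> real). iwasawa_deriv x y \<theta> (hx, hy, ht))"
  have "(M has_derivative D) (at u)"
    unfolding M_def D_def u_def using y by (rule iwasawa_has_derivative)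
  then have M: "((\<lambda>v. M v $ i $ j) has_derivative (\<lambda>h. D h $ i $ j)) (at u)" for i j
    by (intro bounded_linear.has_derivative[OF bounded_linear_vec_nth])
  define Y T P Q :: "s_coord \<Rightarrow> real"
    where "Y = (\<lambda>v. fst (snd v))" "T = (\<lambda>v. fst (snd (snd v)))"
      "P = (\<lambda>v. fst (snd (snd (snd v))))" "Q = (\<lambda>v. fst (snd (snd (snd (snd v)))))"
  note coords = this
  have lin: "(Y has_derivative Y) (at u)" "(T has_derivative T) (at u)"
    "(P has_derivative P) (at u)" "(Q has_derivative Q) (at u)"
    unfolding coords by (auto intro!: derivative_eq_intros)
  have at_u: "Y u = y" "T u = \<theta>" "P u = p" "Q u = q" by (simp_all add: coords u_def)
  have field:
    "s_field GenF = (\<lambda>v. (Y v * cos (2 * T v), Y v * sin (2 * T v), (sin (T v))\<^sup>2, 0, 0, 0))"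
    "s_field GenG = (\<lambda>v. (Y v * cos (2 * T v), Y v * sin (2 * T v), - (cos (T v))\<^sup>2, 0, 0, 0))"
    "s_field GenH = (\<lambda>v. (- 2 * Y v * sin (2 * T v), 2 * Y v * cos (2 * T v), sin (2 * T v), 0, 0, 0))"
    "s_field GenP = (\<lambda>v. (0, 0, 0, M v$2$2, - M v$1$2, - (P v * M v$1$2 + Q v * M v$2$2)))"
    "s_field GenQ = (\<lambda>v. (0, 0, 0, - M v$2$1, M v$1$1, P v * M v$1$1 + Q v * M v$2$1))"
    "s_field GenR = (\<lambda>v. (0, 0, 0, 0, 0, 1))"
    by (auto simp: fun_eq_iff coords M_def Let_def)
  have deriv:
    "s_field_deriv GenF u = (\<lambda>h. (Y h * cos (2 * \<theta>) - 2 * y * sin (2 * \<theta>) * T h,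
       Y h * sin (2 * \<theta>) + 2 * y * cos (2 * \<theta>) * T h, sin (2 * \<theta>) * T h, 0, 0, 0))"
    "s_field_deriv GenG u = (\<lambda>h. (Y h * cos (2 * \<theta>) - 2 * y * sin (2 * \<theta>) * T h,
       Y h * sin (2 * \<theta>) + 2 * y * cos (2 * \<theta>) * T h, sin (2 * \<theta>) * T h, 0, 0, 0))"
    "s_field_deriv GenH u = (\<lambda>h. (- 2 * Y h * sin (2 * \<theta>) - 4 * y * cos (2 * \<theta>) * T h,
       2 * Y h * cos (2 * \<theta>) - 4 * y * sin (2 * \<theta>) * T h, 2 * cos (2 * \<theta>) * T h, 0, 0, 0))"
    "s_field_deriv GenP u = (\<lambda>h. (0, 0, 0, D h$2$2, - D h$1$2,
       - (P h * M u$1$2 + p * D h$1$2 + Q h * M u$2$2 + q * D h$2$2)))"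
    "s_field_deriv GenQ u = (\<lambda>h. (0, 0, 0, - D h$2$1, D h$1$1,
       P h * M u$1$1 + p * D h$1$1 + Q h * M u$2$1 + q * D h$2$1))"
    "s_field_deriv GenR u = (\<lambda>h. (0, 0, 0, 0, 0, 0))"
    by (auto simp: fun_eq_iff coords M_def D_def u_def Let_def zero_prod_def)
  have double: "sin (\<theta> * 2) = 2 * sin \<theta> * cos \<theta>"
    using sin_double[of \<theta>] by (simp add: mult.commute)
  show ?thesis
    by (cases A; simp only: field deriv;
      auto intro!: derivative_eq_intros lin M
        simp: at_u double algebra_simps power2_eq_square zero_prod_def)
qed

text \<open>The brackets among \<open>F, G, H\<close> are identities between \<open>cos 2\<theta>\<close> and \<open>sin 2\<theta>\<close>. In a bracket of one
  of them with \<open>P\<close> or \<open>Q\<close> only the derivative of the latter field contributes, and it is read off from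
  \<open>M X\<close>. The bracket of \<open>P\<close> and \<open>Q\<close> is \<open>2 det M\<close> times \<open>\<partial>\<^sub>\<kappa>\<close>.\<close>

lemma s_field_commutation_relations:
  fixes x y \<theta> p q \<kappa> :: real
  assumes y: "y > 0"
  defines "u \<equiv> (x, y, \<theta>, p, q, \<kappa>)"
  shows "jacobi_commutation_relations
    (\<lambda>A B. s_field_deriv B u (s_field A u) - s_field_deriv A u (s_field B u)) (\<lambda>A. s_field A u)"
proof -
  define br where "br = (\<lambda>A B. s_field_deriv B u (s_field A u) - s_field_deriv A u (s_field B u))"
  \<comment> \<open>makes every component of \<open>L\<^sup>F, L\<^sup>G, L\<^sup>H\<close> a polynomial in \<open>y\<close> and the functions of \<open>2\<theta>\<close>\<close>
  have half: "(sin \<theta>)\<^sup>2 = (1 - cos (2 * \<theta>)) / 2" "(cos \<theta>)\<^sup>2 = (1 + cos (2 * \<theta>)) / 2"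
    using cos_double_sin[of \<theta>] cos_double_cos[of \<theta>] by (simp_all add: field_simps)
  have det: "iwasawa x y \<theta>$1$1 * iwasawa x y \<theta>$2$2 = 1 + iwasawa x y \<theta>$1$2 * iwasawa x y \<theta>$2$1"
    using det_iwasawa[OF y, of x \<theta>] by (simp add: det_2)
  have sc: "sin (2 * \<theta>) * sin (2 * \<theta>) + cos (2 * \<theta>) * cos (2 * \<theta>) = 1" by (simp add: power2_eq_square[symmetric])
  note D = iwasawa_deriv_s_field[OF y, simplified]
  define S C where "S = sin (2 * \<theta>)" "C = cos (2 * \<theta>)"
  note SC = this
  have SC_unit: "S * S + C * C = 1" using sc by (simp add: SC)
  have sl2: "br GenF GenG = s_field GenH u" "br GenG GenH = 2 *\<^sub>R s_field GenG u"
    "br GenH GenF = 2 *\<^sub>R s_field GenF u"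
    by (simp add: br_def u_def half SC[symmetric] zero_prod_def; intro conjI;
        simp add: field_simps; use SC_unit in algebra)+
  have heis: "br GenP GenQ = 2 *\<^sub>R s_field GenR u"
    using det
    by (simp add: br_def u_def D matrix_matrix_mult_def sum_2 zero_prod_def Let_def algebra_simps)
  have mixed: "br GenP GenF = s_field GenQ u" "br GenQ GenG = s_field GenP u"
    "br GenP GenH = s_field GenP u" "br GenH GenQ = s_field GenQ u"
    by (simp_all add: br_def u_def D matrix_matrix_mult_def sum_2 zero_prod_def Let_def)
  have "br A B = 0" if "{A, B} \<notin> {{GenF, GenG}, {GenG, GenH}, {GenH, GenF}, {GenP, GenQ},
      {GenP, GenF}, {GenQ, GenG}, {GenP, GenH}, {GenH, GenQ}}" for A B
    using that
    by (cases A; cases B; simp add: doubleton_eq_iff;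
        simp add: br_def u_def D matrix_matrix_mult_def sum_2 zero_prod_def Let_def)
  then show ?thesis
    unfolding jacobi_commutation_relations_def br_def[symmetric] using sl2 heis mixed by blast
qed

lemma gen_commutation_relations:
  "jacobi_commutation_relations (\<lambda>A B. gen A ** gen B - gen B ** gen A) gen"
proof -
  define br where "br = (\<lambda>A B. gen A ** gen B - gen B ** gen A)"
  note simps = br_def E_mult matrix_mult.diff_left matrix_mult.diff_right matrix_mult.add_left
    matrix_mult.add_right
  have "br GenF GenG = gen GenH" "br GenG GenH = 2 *\<^sub>R gen GenG" "br GenH GenF = 2 *\<^sub>R gen GenF"
    "br GenP GenQ = 2 *\<^sub>R gen GenR" "br GenP GenF = gen GenQ" "br GenQ GenG = gen GenP"
    "br GenP GenH = gen GenP" "br GenH GenQ = gen GenQ"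
    by (simp_all add: simps scaleR_2)
  moreover have "br A B = 0" if "{A, B} \<notin> {{GenF, GenG}, {GenG, GenH}, {GenH, GenF}, {GenP, GenQ},
      {GenP, GenF}, {GenQ, GenG}, {GenP, GenH}, {GenH, GenQ}}" for A B
    using that by (cases A; cases B; simp add: doubleton_eq_iff; simp add: simps)
  ultimately show ?thesis
    unfolding jacobi_commutation_relations_def br_def[symmetric] by blast
qed

section \<open>The dual forms and fields\<close>

text \<open>Linear independence of the generators makes the description that defines the one-forms determine
  them.\<close>

lemma left_form_mult:
  assumes "g \<in> jacobi_group"
  shows "left_form A g (g ** (\<Sum>B\<in>UNIV. c B *\<^sub>R gen B)) = c A"
proof -
  have "matrix_inv g ** (g ** X) = X" for X
    using matrix_inv_inverse(1)[OF invertible_jacobi_group[OF assms]] by (simp add: matrix_mul_assoc)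
  then have "(THE c'. matrix_inv g ** (g ** (\<Sum>B\<in>UNIV. c B *\<^sub>R gen B)) = (\<Sum>B\<in>UNIV. c' B *\<^sub>R gen B)) = c"
    by (intro the_equality) (auto dest: gen_independent)
  then show ?thesis by (simp add: left_form_def)
qed

text \<open>The curve is the image of the line through the coordinates \<open>u\<close> of \<open>g\<close> in the direction \<open>\<xi>\<close> of the
  claimed components. The line may leave the half space \<open>y > 0\<close>, so \<open>t\<close> is bounded by \<open>\<epsilon>\<close>.\<close>

lemma gen_mult_in_tangent_space:
  assumes "g \<in> jacobi_group"
  shows "g ** gen A \<in> tangent_space jacobi_group g"
proof -
  obtain x y \<theta> p q \<kappa> where y: "y > 0" and g: "g = s_param (x, y, \<theta>, p, q, \<kappa>)"
    using assms unfolding s_param_image[symmetric] by auto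
  define u where "u = (x, y, \<theta>, p, q, \<kappa>)"
  define \<xi> where "\<xi> = s_field A u"
  define \<eta> where "\<eta> = fst (snd \<xi>)"
  \<comment> \<open>the summand one keeps the bound finite and positive when the line has constant \<open>y\<close>\<close>
  define \<epsilon> where "\<epsilon> = y / (\<bar>\<eta>\<bar> + 1)"
  have "\<epsilon> > 0" using y by (simp add: \<epsilon>_def)
  moreover have "s_param (u + t *\<^sub>R \<xi>) \<in> jacobi_group" if t: "\<bar>t\<bar> < \<epsilon>" for t
  proof -
    have "\<bar>t * \<eta>\<bar> \<le> \<bar>t\<bar> * (\<bar>\<eta>\<bar> + 1)" by (simp add: abs_mult algebra_simps)
    also have "\<dots> < y" using t by (simp add: \<epsilon>_def pos_less_divide_eq)
    finally have "y + t * \<eta> > 0" by linarith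
    then have "u + t *\<^sub>R \<xi> \<in> {(x, y, \<theta>, p, q, \<kappa>). y > 0}"
      by (simp add: u_def \<eta>_def case_prod_unfold)
    then show ?thesis unfolding s_param_image[symmetric] by (rule imageI)
  qed
  moreover have "((\<lambda>t. s_param (u + t *\<^sub>R \<xi>)) has_vector_derivative g ** gen A) (at 0)"
  proof -
    have line: "((\<lambda>t::real. u + t *\<^sub>R \<xi>) has_derivative (\<lambda>t. t *\<^sub>R \<xi>)) (at 0)"
      using has_derivative_add[OF has_derivative_const
          bounded_linear_imp_has_derivative[OF bounded_linear_scaleR_left]] by simp
    have D: "(s_param has_derivative s_param_deriv u) (at u)"
      unfolding u_def by (rule s_param_has_derivative[OF y])
    then have "(s_param has_derivative s_param_deriv u) (at (u + 0 *\<^sub>R \<xi>))" by simp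
    with line have "((\<lambda>t. s_param (u + t *\<^sub>R \<xi>)) has_derivative (\<lambda>t. s_param_deriv u (t *\<^sub>R \<xi>))) (at 0)"
      by (rule has_derivative_compose)
    moreover have "s_param_deriv u \<xi> = g ** gen A"
      unfolding \<xi>_def u_def g by (rule s_param_deriv_s_field[OF y])
    then have "s_param_deriv u (t *\<^sub>R \<xi>) = t *\<^sub>R (g ** gen A)" for t
      by (simp only: linear_cmul[OF has_derivative_linear[OF D]])
    ultimately show ?thesis by (simp add: has_vector_derivative_def)
  qed
  ultimately show ?thesis
    unfolding tangent_space_def mem_Collect_eq
    by (intro exI[of _ "\<lambda>t. s_param (u + t *\<^sub>R \<xi>)"] exI[of _ \<epsilon>]) (simp add: g u_def)
qed

lemma dual_to_left_forms_iff:
  assumes g: "g \<in> jacobi_group" and v: "v \<in> tangent_space jacobi_group g"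
  shows "(\<forall>B. left_form B g v = (if A = B then 1 else 0)) \<longleftrightarrow> v = g ** gen A"
proof -
  obtain c where c: "v = g ** (\<Sum>B\<in>UNIV. c B *\<^sub>R gen B)"
    using tangent_vector_in_jacobi_algebra[OF g v] by blast
  have gen: "gen A = (\<Sum>B\<in>UNIV. (if A = B then 1 else 0) *\<^sub>R gen B)"
    by (simp add: if_distrib[of "\<lambda>c. c *\<^sub>R _"] cong: if_cong)
  show ?thesis
  proof
    assume "\<forall>B. left_form B g v = (if A = B then 1 else 0)"
    then have "c = (\<lambda>B. if A = B then 1 else 0)" by (simp add: fun_eq_iff c left_form_mult[OF g])
    then show "v = g ** gen A" by (simp add: c gen[symmetric])
  next
    assume "v = g ** gen A"
    then show "\<forall>B. left_form B g v = (if A = B then 1 else 0)"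
      by (subst (asm) gen) (simp only: left_form_mult[OF g] simp_thms)
  qed
qed

lemma left_field_eq:
  assumes g: "g \<in> jacobi_group"
  shows "left_field A g = g ** gen A"
  unfolding left_field_def
proof (rule the_equality)
  show "g ** gen A \<in> tangent_space jacobi_group g \<and>
      (\<forall>B. left_form B g (g ** gen A) = (if A = B then 1 else 0))"
    using gen_mult_in_tangent_space[OF g] dual_to_left_forms_iff[OF g] by blast
next
  fix v
  assume "v \<in> tangent_space jacobi_group g \<and> (\<forall>B. left_form B g v = (if A = B then 1 else 0))"
  then show "v = g ** gen A" using dual_to_left_forms_iff[OF g] by blast
qed

lemma left_form_invariant:
  assumes "g \<in> jacobi_group" "h \<in> jacobi_group"
  shows "left_form A (h ** g) (h ** v) = left_form A g v"
proof -
  have hg: "matrix_inv (h ** g) ** h ** g = mat 1"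
    unfolding matrix_mul_assoc[symmetric]
    by (intro matrix_inv_inverse invertible_jacobi_group jacobi_group_mult_closed assms)
  have "matrix_inv (h ** g) ** h = matrix_inv (h ** g) ** h ** (g ** matrix_inv g)"
    by (simp add: matrix_inv_inverse(2) invertible_jacobi_group assms(1))
  also have "\<dots> = matrix_inv (h ** g) ** h ** g ** matrix_inv g"
    by (rule matrix_mul_assoc)
  also have "\<dots> = matrix_inv g" by (simp add: hg)
  finally have "matrix_inv (h ** g) ** h = matrix_inv g" .
  then have "matrix_inv (h ** g) ** (h ** v) = matrix_inv g ** v"
    by (simp add: matrix_mul_assoc)
  then show ?thesis by (simp add: left_form_def)
qed

lemma maurer_cartan_expansion:
  assumes g: "g \<in> jacobi_group" and v: "v \<in> tangent_space jacobi_group g"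
  shows "matrix_inv g ** v = (\<Sum>A\<in>UNIV. left_form A g v *\<^sub>R gen A)"
proof -
  obtain c where c: "v = g ** (\<Sum>B\<in>UNIV. c B *\<^sub>R gen B)"
    using tangent_vector_in_jacobi_algebra[OF g v] by blast
  have "matrix_inv g ** v = (\<Sum>B\<in>UNIV. c B *\<^sub>R gen B)"
    unfolding c using matrix_inv_inverse(1)[OF invertible_jacobi_group[OF g]]
    by (simp add: matrix_mul_assoc)
  then show ?thesis by (simp add: c left_form_mult[OF g])
qed

text \<open>As the derivative of the parametrization is injective, a vector with the right image is the vector of
  components.\<close>

lemma in_s_coords_left_field:
  assumes y: "y > 0"
  shows "in_s_coords (left_field A) (x, y, \<theta>, p, q, \<kappa>) = s_field A (x, y, \<theta>, p, q, \<kappa>)"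
proof -
  let ?u = "(x, y, \<theta>, p, q, \<kappa>)"
  have "s_param ?u \<in> jacobi_group"
    unfolding s_param_image[symmetric] using y by (intro imageI) simp
  then have "frechet_derivative s_param (at ?u) (s_field A ?u) = left_field A (s_param ?u)"
    by (simp only: frechet_derivative_at[OF s_param_has_derivative[OF y], symmetric]
        s_param_deriv_s_field[OF y] left_field_eq)
  then show ?thesis
    unfolding in_s_coords_def
    by (intro the_equality injD[OF inj_s_param_derivative[OF y, of x \<theta> p q \<kappa>]]) (simp_all only:)
qed

text \<open>The components agree with \<open>s_field\<close> on the half space \<open>y > 0\<close> only, but this is open and so
  determines the derivatives in the bracket.\<close>

lemma lie_bracket_in_s_coords:
  fixes x y \<theta> p q \<kappa> :: real
  assumes y: "y > 0"
  defines "u \<equiv> (x, y, \<theta>, p, q, \<kappa>)"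
  shows "lie_bracket (in_s_coords (left_field A)) (in_s_coords (left_field B)) u =
    s_field_deriv B u (s_field A u) - s_field_deriv A u (s_field B u)"
proof -
  let ?U = "{v :: s_coord. 0 < fst (snd v)}"
  have U: "open ?U" "u \<in> ?U" using y by (auto intro!: open_Collect_less continuous_intros simp: u_def)
  have eq: "s_field A v = in_s_coords (left_field A) v" if "v \<in> ?U" for v A
    using that by (cases v) (simp add: in_s_coords_left_field)
  have "(in_s_coords (left_field A) has_derivative s_field_deriv A u) (at u)" for A
    by (rule has_derivative_transform_within_open[OF _ U eq])
       (auto simp: u_def intro: s_field_has_derivative[OF y])
  then have "frechet_derivative (in_s_coords (left_field A)) (at u) = s_field_deriv A u" for A
    by (rule frechet_derivative_at[symmetric])
  then show ?thesis using eq[OF U(2)] by (simp add: lie_bracket_def)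
qed

text \<open>The form of the entries in which the explicit components of \<open>L\<^sup>P\<close> and \<open>L\<^sup>Q\<close> are written.\<close>

lemma iwasawa_common_denominator:
  assumes "y > 0"
  shows "iwasawa x y \<theta> = vector
    [vector [(y * cos \<theta> - x * sin \<theta>) / sqrt y, (x * cos \<theta> + y * sin \<theta>) / sqrt y],
     vector [- sin \<theta> / sqrt y, cos \<theta> / sqrt y]]"
proof -
  have "y / sqrt y = sqrt y" using assms by (simp add: real_div_sqrt)
  then have "y * c / sqrt y = sqrt y * c" for c by (metis times_divide_eq_left)
  then show ?thesis
    by (simp add: iwasawa_def vec_eq_iff forall_2 add_divide_distrib diff_divide_distrib)
qed

theorem proposition5p3:
  shows
    \<comment> \<open>the coefficients of the Maurer--Cartan form are left-invariant one-forms\<close>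
    "(\<forall>g \<in> jacobi_group. \<forall>v \<in> tangent_space jacobi_group g.
        matrix_inv g ** v = (\<Sum>A\<in>UNIV. left_form A g v *\<^sub>R gen A)) \<and>
     (\<forall>A. \<forall>h \<in> jacobi_group. \<forall>g \<in> jacobi_group. \<forall>v \<in> tangent_space jacobi_group g.
        left_form A (h ** g) (h ** v) = left_form A g v) \<and>
     \<comment> \<open>the dual fields exist, are unique and left-invariant\<close>
     (\<forall>A. \<forall>g \<in> jacobi_group. left_field A g \<in> tangent_space jacobi_group g) \<and>
     (\<forall>A. \<forall>g \<in> jacobi_group. \<forall>v \<in> tangent_space jacobi_group g.
        (\<forall>B. left_form B g v = (if A = B then 1 else 0)) \<longleftrightarrow> v = left_field A g) \<and>
     (\<forall>A. \<forall>h \<in> jacobi_group. \<forall>g \<in> jacobi_group. left_field A (h ** g) = h ** left_field A g) \<and>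
     \<comment> \<open>the fields in S-coordinates\<close>
     (\<forall>x y \<theta> p q \<kappa>. y > 0 \<longrightarrow>
       (let u = (x, y, \<theta>, p, q, \<kappa>);
            L = (\<lambda>A. in_s_coords (left_field A) u);
            M = iwasawa x y \<theta>; a = M$1$1; b = M$1$2; c = M$2$1; d = M$2$2
        in L GenF = (y * cos (2 * \<theta>), y * sin (2 * \<theta>), (sin \<theta>)\<^sup>2, 0, 0, 0) \<and>
           L GenG = (y * cos (2 * \<theta>), y * sin (2 * \<theta>), - (cos \<theta>)\<^sup>2, 0, 0, 0) \<and>
           L GenH = (- 2 * y * sin (2 * \<theta>), 2 * y * cos (2 * \<theta>), sin (2 * \<theta>), 0, 0, 0) \<and>
           L GenP = (0, 0, 0, d, - b, - (p * b + q * d)) \<and>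
           L GenP = (0, 0, 0, cos \<theta> / sqrt y, - ((x * cos \<theta> + y * sin \<theta>) / sqrt y),
                     - (1 / sqrt y * (p * (x * cos \<theta> + y * sin \<theta>) + q * cos \<theta>))) \<and>
           L GenQ = (0, 0, 0, - c, a, p * a + q * c) \<and>
           L GenQ = (0, 0, 0, sin \<theta> / sqrt y, (y * cos \<theta> - x * sin \<theta>) / sqrt y,
                     1 / sqrt y * (p * (y * cos \<theta> - x * sin \<theta>) - q * sin \<theta>)) \<and>
           L GenR = (0, 0, 0, 0, 0, 1))) \<and>
     \<comment> \<open>the generators and the fields satisfy the same commutation relations\<close>
     jacobi_commutation_relations (\<lambda>A B. gen A ** gen B - gen B ** gen A) gen \<and>
     (\<forall>x y \<theta> p q \<kappa>. y > 0 \<longrightarrow>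
       (let u = (x, y, \<theta>, p, q, \<kappa>); L = (\<lambda>A. in_s_coords (left_field A))
        in jacobi_commutation_relations (\<lambda>A B. lie_bracket (L A) (L B) u) (\<lambda>A. L A u)))"
proof (intro conjI)
  show "\<forall>g \<in> jacobi_group. \<forall>v \<in> tangent_space jacobi_group g.
      matrix_inv g ** v = (\<Sum>A\<in>UNIV. left_form A g v *\<^sub>R gen A)"
    by (blast intro: maurer_cartan_expansion)
  show "\<forall>A. \<forall>h \<in> jacobi_group. \<forall>g \<in> jacobi_group. \<forall>v \<in> tangent_space jacobi_group g.
      left_form A (h ** g) (h ** v) = left_form A g v"
    by (blast intro: left_form_invariant)
  show "\<forall>A. \<forall>g \<in> jacobi_group. left_field A g \<in> tangent_space jacobi_group g"
    by (simp add: left_field_eq gen_mult_in_tangent_space)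
  show "\<forall>A. \<forall>g \<in> jacobi_group. \<forall>v \<in> tangent_space jacobi_group g.
      (\<forall>B. left_form B g v = (if A = B then 1 else 0)) \<longleftrightarrow> v = left_field A g"
    by (intro allI ballI) (simp only: left_field_eq dual_to_left_forms_iff)
  show "\<forall>A. \<forall>h \<in> jacobi_group. \<forall>g \<in> jacobi_group. left_field A (h ** g) = h ** left_field A g"
    by (simp add: left_field_eq jacobi_group_mult_closed matrix_mul_assoc)
  show "jacobi_commutation_relations (\<lambda>A B. gen A ** gen B - gen B ** gen A) gen"
    by (rule gen_commutation_relations)
  show "\<forall>x y \<theta> p q \<kappa>. y > 0 \<longrightarrow>
    (let u = (x, y, \<theta>, p, q, \<kappa>); L = (\<lambda>A. in_s_coords (left_field A))
     in jacobi_commutation_relations (\<lambda>A B. lie_bracket (L A) (L B) u) (\<lambda>A. L A u))"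
    by (simp add: Let_def lie_bracket_in_s_coords in_s_coords_left_field s_field_commutation_relations)
qed (simp add: Let_def in_s_coords_left_field iwasawa_common_denominator add_divide_distrib
  diff_divide_distrib distrib_left right_diff_distrib)

end
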